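(* There exists an $O(nd)$ time reduction from $\mathsf{2D\;LWS}_n$ with slice rank $d$ and $w_1=w_2=w$ to $\mathsf{2D\;LWS}^{\mathsf{PT}}_{2n}$ with slice rank $d$: given a decomposition of $w:[n]^3\to\mathbb{Z}$ into $d$ slice-rank-$1$ tensors, one can compute in $O(nd)$ time a decomposition into $d$ slice-rank-$1$ tensors of a tensor $w':[2n]^3\to\mathbb{Z}$ such that the answer of $\mathsf{2D\;LWS}^{\mathsf{PT}}$ on $w'$ equals the answer of $\mathsf{2D\;LWS}$ on $(w_1,w_2)=(w,w)$.
   Context: A tensor $w:[n]^3\to\mathbb{R}$ has slice rank $1$ if it is of one of the forms $w[i,j,k]=a(i)b(j,k)$, $a(j)b(i,k)$, or $a(k)b(i,j)$; it has slice rank $d$ if it is a sum of $d$ slice-rank-$1$ tensors, and is given as input via such a decomposition. $\mathsf{2D\;LWS}_n$: given $w_1,w_2:[n]^3\to\{-W,\ldots,W,\infty\}$, define $T[1,1]=0$ and otherwise $T[i,j]=\min\bigl(\min_{1\le k<i}(T[k,j]+w_1[i,j,k]),\ \min_{1\le k<j}(T[i,k]+w_2[i,j,k])\bigr)$; the answer is $T[n,n]$. $\mathsf{2D\;LWS}^{\mathsf{PT}}_m$: given $w:[m]^3\to\{-W,\ldots,W,\infty\}$, define $T[i,j]=0$ if $j-i\le1$ and otherwise $T[i,j]=\min_{i<k<j}(T[i,k]+T[k,j]+w[i,j,k])$; the answer is $T[1,m]$.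
   Formalization: The n×n matrix factors of the slices cannot be written out in O(nd) time; the formal statement writes the vector factors and slice kinds explicitly in O(nd) steps and gives each output matrix entry by an O(1)-time query that may read the input decomposition. It takes n, d ≥ 1. *)

theory Defs
  imports "HOL-Library.Extended_Real"
begin

section \<open>The two dynamic programs\<close>

text \<open>
  The index set \<open>[n]\<close> is \<open>{1..n}\<close>. Weights are extended reals, so that \<open>\<infinity>\<close> is available; the
  infimum over an empty index range is \<open>\<infinity>\<close>, and over a nonempty one it is the minimum.
\<close>

function lws2d_table ::
  "(nat \<Rightarrow> nat \<Rightarrow> nat \<Rightarrow> ereal) \<Rightarrow> (nat \<Rightarrow> nat \<Rightarrow> nat \<Rightarrow> ereal) \<Rightarrow> nat \<Rightarrow> nat \<Rightarrow> ereal"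
  where
    "lws2d_table w1 w2 i j =
      (if i = 1 \<and> j = 1 then 0
       else min (INF k\<in>{1..<i}. lws2d_table w1 w2 k j + w1 i j k)
                (INF k\<in>{1..<j}. lws2d_table w1 w2 i k + w2 i j k))"
  by pat_completeness auto
termination
  by (relation "measure (\<lambda>(w1, w2, i, j). i + j)") auto

declare lws2d_table.simps [simp del]

definition lws2d ::
  "nat \<Rightarrow> (nat \<Rightarrow> nat \<Rightarrow> nat \<Rightarrow> ereal) \<Rightarrow> (nat \<Rightarrow> nat \<Rightarrow> nat \<Rightarrow> ereal) \<Rightarrow> ereal"
  where "lws2d n w1 w2 = lws2d_table w1 w2 n n"

function pt_table :: "(nat \<Rightarrow> nat \<Rightarrow> nat \<Rightarrow> ereal) \<Rightarrow> nat \<Rightarrow> nat \<Rightarrow> ereal"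
  where
    "pt_table w i j =
      (if j \<le> i + 1 then 0
       else (INF k\<in>{i<..<j}. pt_table w i k + pt_table w k j + w i j k))"
  by pat_completeness auto
termination
  by (relation "measure (\<lambda>(w, i, j). j - i)") auto

declare pt_table.simps [simp del]

definition lws2d_pt :: "nat \<Rightarrow> (nat \<Rightarrow> nat \<Rightarrow> nat \<Rightarrow> ereal) \<Rightarrow> ereal"
  where "lws2d_pt m w = pt_table w 1 m"

text \<open>Integer tensors as weights (no infinite entries).\<close>

definition int_weights :: "(nat \<Rightarrow> nat \<Rightarrow> nat \<Rightarrow> int) \<Rightarrow> nat \<Rightarrow> nat \<Rightarrow> nat \<Rightarrow> ereal"
  where "int_weights w i j k = ereal (real_of_int (w i j k))"


section \<open>Slice rank decompositions\<close>

datatype slice =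
    SliceI "nat \<Rightarrow> real" "nat \<Rightarrow> nat \<Rightarrow> real"
  | SliceJ "nat \<Rightarrow> real" "nat \<Rightarrow> nat \<Rightarrow> real"
  | SliceK "nat \<Rightarrow> real" "nat \<Rightarrow> nat \<Rightarrow> real"

fun slice_tensor :: "slice \<Rightarrow> nat \<Rightarrow> nat \<Rightarrow> nat \<Rightarrow> real"
  where
    "slice_tensor (SliceI a b) i j k = a i * b j k"
  | "slice_tensor (SliceJ a b) i j k = a j * b i k"
  | "slice_tensor (SliceK a b) i j k = a k * b i j"

text \<open>
  The number of summands is \<open>length D\<close>. The factors may be real even though the sum is integral.
  Values of factors outside the index set are irrelevant.
\<close>

definition slice_decomposition :: "nat \<Rightarrow> slice list \<Rightarrow> (nat \<Rightarrow> nat \<Rightarrow> nat \<Rightarrow> int) \<Rightarrow> bool"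
  where
    "slice_decomposition n D w \<longleftrightarrow>
      (\<forall>i\<in>{1..n}. \<forall>j\<in>{1..n}. \<forall>k\<in>{1..n}.
        real_of_int (w i j k) = (\<Sum>s\<leftarrow>D. slice_tensor s i j k))"

fun slice_kind :: "slice \<Rightarrow> nat"
  where
    "slice_kind (SliceI a b) = 0"
  | "slice_kind (SliceJ a b) = 1"
  | "slice_kind (SliceK a b) = 2"

fun slice_vec :: "slice \<Rightarrow> nat \<Rightarrow> real"
  where
    "slice_vec (SliceI a b) = a"
  | "slice_vec (SliceJ a b) = a"
  | "slice_vec (SliceK a b) = a"

fun slice_mat :: "slice \<Rightarrow> nat \<Rightarrow> nat \<Rightarrow> real"
  where
    "slice_mat (SliceI a b) = b"
  | "slice_mat (SliceJ a b) = b"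
  | "slice_mat (SliceK a b) = b"


section \<open>The machine model\<close>

text \<open>
  A unit-cost random access machine. Index words are natural numbers with addition and truncated
  subtraction; there is no multiplication. Numerical values are reals, held in separate registers
  and cells, and can only be moved or set to zero, so no cost is hidden in real arithmetic and
  every value produced is an input value or zero. The input decomposition is read-only and
  randomly accessible: one step reads the kind of a summand, one entry of its vector, or one entry
  of its matrix.
\<close>

record machine =
  reg :: "nat \<Rightarrow> nat"
  mem :: "nat \<Rightarrow> nat"
  vreg :: "nat \<Rightarrow> real"
  vmem :: "nat \<Rightarrow> real"

datatype instr =
    Const nat nat
  | Add nat nat nat
  | Sub nat nat nat
  | Load nat nat
  | Store nat nat
  | VZero nat
  | VLoad nat nat
  | VStore nat nat
  | GetKind nat nat
  | GetVec nat nat nat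
  | GetMat nat nat nat nat

fun step :: "slice list \<Rightarrow> instr \<Rightarrow> machine \<Rightarrow> machine"
  where
    "step D (Const r c) s = s\<lparr>reg := (reg s)(r := c)\<rparr>"
  | "step D (Add r p q) s = s\<lparr>reg := (reg s)(r := reg s p + reg s q)\<rparr>"
  | "step D (Sub r p q) s = s\<lparr>reg := (reg s)(r := reg s p - reg s q)\<rparr>"
  | "step D (Load r p) s = s\<lparr>reg := (reg s)(r := mem s (reg s p))\<rparr>"
  | "step D (Store p r) s = s\<lparr>mem := (mem s)(reg s p := reg s r)\<rparr>"
  | "step D (VZero v) s = s\<lparr>vreg := (vreg s)(v := 0)\<rparr>"
  | "step D (VLoad v p) s = s\<lparr>vreg := (vreg s)(v := vmem s (reg s p))\<rparr>"
  | "step D (VStore p v) s = s\<lparr>vmem := (vmem s)(reg s p := vreg s v)\<rparr>"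
  | "step D (GetKind r t) s = s\<lparr>reg := (reg s)(r := slice_kind (D ! reg s t))\<rparr>"
  | "step D (GetVec v t i) s =
       s\<lparr>vreg := (vreg s)(v := slice_vec (D ! reg s t) (reg s i))\<rparr>"
  | "step D (GetMat v t j k) s =
       s\<lparr>vreg := (vreg s)(v := slice_mat (D ! reg s t) (reg s j) (reg s k))\<rparr>"

text \<open>Branching and looping test whether the first register is smaller than the second.\<close>

datatype prog =
    Skip
  | Do instr
  | Seq prog prog
  | IfLess nat nat prog prog
  | WhileLess nat nat prog

text \<open>
  \<open>exec D P s T s'\<close>: with input \<open>D\<close>, program \<open>P\<close> started in \<open>s\<close> halts in \<open>s'\<close> after exactly \<open>T\<close> steps.
\<close>

inductive exec :: "slice list \<Rightarrow> prog \<Rightarrow> machine \<Rightarrow> nat \<Rightarrow> machine \<Rightarrow> bool"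
  for D :: "slice list"
  where
    Skip: "exec D Skip s 0 s"
  | Do: "exec D (Do x) s 1 (step D x s)"
  | Seq: "exec D P s T s' \<Longrightarrow> exec D Q s' T' s'' \<Longrightarrow> exec D (Seq P Q) s (T + T') s''"
  | IfTrue: "reg s p < reg s q \<Longrightarrow> exec D P s T s' \<Longrightarrow> exec D (IfLess p q P Q) s (1 + T) s'"
  | IfFalse: "\<not> reg s p < reg s q \<Longrightarrow> exec D Q s T s' \<Longrightarrow> exec D (IfLess p q P Q) s (1 + T) s'"
  | WhileFalse: "\<not> reg s p < reg s q \<Longrightarrow> exec D (WhileLess p q P) s 1 s"
  | WhileTrue: "reg s p < reg s q \<Longrightarrow> exec D P s T s' \<Longrightarrow> exec D (WhileLess p q P) s' T' s'' \<Longrightarrow>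
      exec D (WhileLess p q P) s (1 + T + T') s''"

inductive_cases exec_SkipE: "exec D Skip s T s'"
inductive_cases exec_DoE: "exec D (Do x) s T s'"
inductive_cases exec_SeqE: "exec D (Seq P Q) s T s'"
inductive_cases exec_IfE: "exec D (IfLess p q P Q) s T s'"
inductive_cases exec_WhileE: "exec D (WhileLess p q P) s T s'"

lemma exec_deterministic:
  "exec D P s T s' \<Longrightarrow> exec D P s U u \<Longrightarrow> U = T \<and> u = s'"
proof (induction arbitrary: U u rule: exec.induct)
  case (Skip s)
  then show ?case by (auto elim: exec_SkipE)
next
  case (Do x s)
  then show ?case by (auto elim: exec_DoE)
next
  case (Seq P s T s' Q T' s'')
  from Seq.prems obtain A B x where *: "exec D P s A x" "exec D Q x B u" "U = A + B"
    by (rule exec_SeqE)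
  with Seq.IH(1)[OF *(1)] Seq.IH(2)[of B u] show ?case by simp
next
  case (IfTrue s p q P T s' Q)
  from IfTrue.prems IfTrue.hyps(1) obtain A where *: "exec D P s A u" "U = 1 + A"
    by (auto elim: exec_IfE)
  with IfTrue.IH[OF *(1)] show ?case by simp
next
  case (IfFalse s p q Q T s' P)
  from IfFalse.prems IfFalse.hyps(1) obtain A where *: "exec D Q s A u" "U = 1 + A"
    by (auto elim: exec_IfE)
  with IfFalse.IH[OF *(1)] show ?case by simp
next
  case (WhileFalse s p q P)
  from WhileFalse.prems show ?case
    by (rule exec_WhileE) (simp_all add: WhileFalse.hyps)
next
  case (WhileTrue s p q P T s' T' s'')
  from WhileTrue.prems obtain A B x
    where *: "exec D P s A x" "exec D (WhileLess p q P) x B u" "U = 1 + A + B"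
    by (rule exec_WhileE) (use WhileTrue.hyps(1) in simp_all)
  with WhileTrue.IH(1)[OF *(1)] WhileTrue.IH(2)[of B u] show ?case by simp
qed

definition initial :: "nat \<Rightarrow> nat \<Rightarrow> machine"
  where
    "initial n d =
      \<lparr>reg = (\<lambda>_. 0)(0 := n, 1 := d), mem = (\<lambda>_. 0), vreg = (\<lambda>_. 0), vmem = (\<lambda>_. 0)\<rparr>"

text \<open>
  How a machine state represents an output decomposition \<open>D'\<close> of a tensor on \<open>[m]\<^sup>3\<close>. Its header,
  the kinds of the summands and all entries of their vectors are written out in memory. An
  \<open>m \<times> m\<close> matrix cannot be written out in time linear in \<open>m\<close>, so each matrix is represented by
  random access instead: the program \<open>query\<close>, given summand number and row and column index in
  registers 2, 3 and 4, leaves the entry in value register 0 after at most \<open>c\<close> steps. It may read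
  the memory contents left by the reduction and the reduction's input \<open>D\<close>.
\<close>

definition represents ::
  "slice list \<Rightarrow> prog \<Rightarrow> nat \<Rightarrow> machine \<Rightarrow> nat \<Rightarrow> slice list \<Rightarrow> bool"
  where
    "represents D query c s m D' \<longleftrightarrow>
      reg s 0 = m \<and> reg s 1 = length D' \<and>
      (\<forall>t<length D'.
        mem s t = slice_kind (D' ! t) \<and>
        (\<forall>i\<in>{1..m}. vmem s (t * m + (i - 1)) = slice_vec (D' ! t) i) \<and>
        (\<forall>j\<in>{1..m}. \<forall>k\<in>{1..m}. \<exists>T s'.
          exec D query (s\<lparr>reg := (reg s)(2 := t, 3 := j, 4 := k)\<rparr>) T s' \<and>
          T \<le> c \<and> vreg s' 0 = slice_mat (D' ! t) j k))"

end

theory Submission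
  imports Defs
begin

text \<open>
  Cut the polygon \<open>1, \<dots>, 2n\<close> between \<open>n\<close> and \<open>n + 1\<close>. The interval \<open>[n + 1 - i, n + j]\<close> plays the
  role of the cell \<open>(i, j)\<close>: splitting it at a vertex of the left half shortens \<open>i\<close>, splitting it at
  a vertex of the right half shortens \<open>j\<close>. Give weight \<open>0\<close> to every interval that does not straddle
  the cut; then the part split off costs nothing, and the two recurrences coincide. Since the two
  halves carry the same tensor, a split point \<open>k\<close> only matters through its distance to the cut, and
  so each slice of \<open>w\<close> turns into one slice of the new tensor.
\<close>

section \<open>Mirroring at the cut\<close>

text \<open>The distance to the cut, counted so that \<open>n\<close> and \<open>n + 1\<close> both
  get 1; the left half is thereby reversed.\<close>

definition mirror :: "nat \<Rightarrow> nat \<Rightarrow> nat"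
  where "mirror n i = (if n < i then i - n else n + 1 - i)"

definition mirror_tensor :: "nat \<Rightarrow> (nat \<Rightarrow> nat \<Rightarrow> nat \<Rightarrow> int) \<Rightarrow> nat \<Rightarrow> nat \<Rightarrow> nat \<Rightarrow> int"
  where "mirror_tensor n w i j k =
    (if i \<le> n \<and> n < j then w (mirror n i) (mirror n j) (mirror n k) else 0)"

text \<open>The indicator of \<open>i \<le> n \<and> n < j\<close> is a product of a condition on
  \<open>i\<close> and one on \<open>j\<close>. Each goes to the factor that sees its index, so the
  result is still a single slice of the same kind.\<close>

fun mirror_slice :: "nat \<Rightarrow> slice \<Rightarrow> slice"
  where
    "mirror_slice n (SliceI a b) = SliceI
      (\<lambda>i. if i \<le> n then a (mirror n i) else 0)
      (\<lambda>j k. if n < j then b (mirror n j) (mirror n k) else 0)"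
  | "mirror_slice n (SliceJ a b) = SliceJ
      (\<lambda>j. if n < j then a (mirror n j) else 0)
      (\<lambda>i k. if i \<le> n then b (mirror n i) (mirror n k) else 0)"
  | "mirror_slice n (SliceK a b) = SliceK
      (\<lambda>k. a (mirror n k))
      (\<lambda>i j. if i \<le> n \<and> n < j then b (mirror n i) (mirror n j) else 0)"

lemma mirror_in_range: "i \<in> {1..2 * n} \<Longrightarrow> mirror n i \<in> {1..n}"
  by (auto simp: mirror_def)

lemma slice_tensor_mirror_slice:
  "slice_tensor (mirror_slice n s) i j k =
    (if i \<le> n \<and> n < j then slice_tensor s (mirror n i) (mirror n j) (mirror n k) else 0)"
  by (cases s) auto

lemma slice_decomposition_mirror:
  assumes "slice_decomposition n D w"
  shows "slice_decomposition (2 * n) (map (mirror_slice n) D) (mirror_tensor n w)"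
  unfolding slice_decomposition_def
proof (intro ballI)
  fix i j k assume "i \<in> {1..2 * n}" "j \<in> {1..2 * n}" "k \<in> {1..2 * n}"
  then have "real_of_int (w (mirror n i) (mirror n j) (mirror n k)) =
      (\<Sum>s\<leftarrow>D. slice_tensor s (mirror n i) (mirror n j) (mirror n k))"
    using assms mirror_in_range unfolding slice_decomposition_def by blast
  then show "real_of_int (mirror_tensor n w i j k) =
      (\<Sum>s\<leftarrow>map (mirror_slice n) D. slice_tensor s i j k)"
    by (auto simp: mirror_tensor_def slice_tensor_mirror_slice comp_def)
qed

section \<open>Agreement of the two dynamic programs\<close>

text \<open>Splitting an interval on one side of the cut leaves both pieces on that side, so only
  weights 0 are ever added.\<close>

lemma pt_table_mirror_half:
  "j \<le> n \<or> n < i \<Longrightarrow> pt_table (int_weights (mirror_tensor n w)) i j = 0"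
proof (induction "j - i" arbitrary: i j rule: less_induct)
  case less
  show ?case
  proof (cases "j \<le> i + 1")
    case False
    have "pt_table (int_weights (mirror_tensor n w)) i k
        + pt_table (int_weights (mirror_tensor n w)) k j
        + int_weights (mirror_tensor n w) i j k = 0" if "k \<in> {i<..<j}" for k
    proof -
      have "pt_table (int_weights (mirror_tensor n w)) i k = 0"
        using that less.prems by (intro less.hyps) auto
      moreover have "pt_table (int_weights (mirror_tensor n w)) k j = 0"
        using that less.prems by (intro less.hyps) auto
      moreover have "int_weights (mirror_tensor n w) i j k = 0"
        using less.prems by (auto simp: int_weights_def mirror_tensor_def)
      ultimately show ?thesis by simp
    qed
    \<comment> \<open>Over an empty range the infimum would be \<infinity> instead of 0.\<close>
    moreover have "i + 1 \<in> {i<..<j}"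
      using False by auto
    then have "{i<..<j} \<noteq> {}"
      by blast
    ultimately show ?thesis
      using False by (subst pt_table.simps) simp
  qed (simp add: pt_table.simps)
qed

lemma pt_table_mirror:
  assumes "1 \<le> i" "i \<le> n" "1 \<le> j"
  shows "pt_table (int_weights (mirror_tensor n w)) (n + 1 - i) (n + j) =
    lws2d_table (int_weights w) (int_weights w) i j"
  using assms
proof (induction "i + j" arbitrary: i j rule: less_induct)
  case less
  let ?P = "pt_table (int_weights (mirror_tensor n w))"
  let ?W = "int_weights (mirror_tensor n w)"
  let ?L = "lws2d_table (int_weights w) (int_weights w)"
  show ?case
  proof (cases "i = 1 \<and> j = 1")
    case True
    \<comment> \<open>The interval is \<open>[n, n + 1]\<close>: its ends are adjacent, so both
      tables have their base value 0.\<close>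
    then show ?thesis by (simp add: pt_table.simps lws2d_table.simps)
  next
    case False
    define l where "l = n + 1 - i"
    define r where "r = n + j"
    \<comment> \<open>Split points left and right of the cut supply the first and the second minimum
      of the \<open>lws2d_table\<close> recurrence.\<close>
    have cut: "{l<..<r} = (\<lambda>k. n + 1 - k) ` {1..<i} \<union> (\<lambda>k. n + k) ` {1..<j}"
    proof (intro equalityI subsetI)
      fix c assume c: "c \<in> {l<..<r}"
      show "c \<in> (\<lambda>k. n + 1 - k) ` {1..<i} \<union> (\<lambda>k. n + k) ` {1..<j}"
      proof (cases "n < c")
        case True
        then have "c = n + (c - n)" "c - n \<in> {1..<j}"
          using c by (auto simp: r_def)
        then show ?thesis by blast
      next
        case False
        then have "c = n + 1 - (n + 1 - c)" "n + 1 - c \<in> {1..<i}"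
          using c less.prems by (auto simp: l_def)
        then show ?thesis by blast
      qed
    qed (use less.prems in \<open>auto simp: l_def r_def\<close>)
    have left: "?P l (n + 1 - k) + ?P (n + 1 - k) r + ?W l r (n + 1 - k) =
        ?L k j + int_weights w i j k" if "k \<in> {1..<i}" for k
    proof -
      have "?P l (n + 1 - k) = 0"
        using that by (intro pt_table_mirror_half) auto
      moreover have "?P (n + 1 - k) r = ?L k j"
        unfolding r_def using that less.prems by (intro less.hyps) auto
      moreover have "?W l r (n + 1 - k) = int_weights w i j k"
        using that less.prems
        by (auto simp: int_weights_def mirror_tensor_def mirror_def l_def r_def)
      ultimately show ?thesis by simp
    qed
    have right: "?P l (n + k) + ?P (n + k) r + ?W l r (n + k) =
        ?L i k + int_weights w i j k" if "k \<in> {1..<j}" for k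
    proof -
      have "?P (n + k) r = 0"
        using that by (intro pt_table_mirror_half) auto
      moreover have "?P l (n + k) = ?L i k"
        unfolding l_def using that less.prems by (intro less.hyps) auto
      moreover have "?W l r (n + k) = int_weights w i j k"
        using that less.prems
        by (auto simp: int_weights_def mirror_tensor_def mirror_def l_def r_def)
      ultimately show ?thesis by simp
    qed
    \<comment> \<open>Here \<open>r - l = i + j - 1\<close> is at least 2, so the recursive branch
      applies.\<close>
    have "?P l r = (INF c\<in>{l<..<r}. ?P l c + ?P c r + ?W l r c)"
      using False less.prems by (subst pt_table.simps) (auto simp: l_def r_def)
    also have "\<dots> = min
        (INF k\<in>{1..<i}. ?P l (n + 1 - k) + ?P (n + 1 - k) r + ?W l r (n + 1 - k))
        (INF k\<in>{1..<j}. ?P l (n + k) + ?P (n + k) r + ?W l r (n + k))"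
      unfolding cut INF_union image_image inf_min ..
    also have "\<dots> = ?L i j"
      by (simp only: left right lws2d_table.simps[of _ _ i j] False if_False cong: INF_cong)
    finally show ?thesis by (simp add: l_def r_def)
  qed
qed

lemma lws2d_pt_mirror:
  assumes "1 \<le> n"
  shows "lws2d_pt (2 * n) (int_weights (mirror_tensor n w)) =
    lws2d n (int_weights w) (int_weights w)"
  using pt_table_mirror[of n n n w] assms by (simp add: lws2d_pt_def lws2d_def mult_2)


section \<open>Reasoning about programs and their cost\<close>

text \<open>Total correctness with cost: a halting run is demanded, and the postcondition also sees
  its step count. By determinism that run is the only one.\<close>

definition wp :: "slice list \<Rightarrow> prog \<Rightarrow> machine \<Rightarrow> (nat \<Rightarrow> machine \<Rightarrow> bool) \<Rightarrow> bool"
  where "wp D P s Q \<longleftrightarrow> (\<exists>T s'. exec D P s T s' \<and> Q T s')"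

lemma wp_mono: "wp D P s Q \<Longrightarrow> (\<And>T s'. Q T s' \<Longrightarrow> R T s') \<Longrightarrow> wp D P s R"
  unfolding wp_def by blast

lemma wp_Skip [simp]: "wp D Skip s Q \<longleftrightarrow> Q 0 s"
  unfolding wp_def by (blast elim: exec_SkipE intro: exec.Skip)

lemma wp_Do [simp]: "wp D (Do x) s Q \<longleftrightarrow> Q 1 (step D x s)"
  unfolding wp_def by (auto elim!: exec_DoE intro: exec.Do[simplified])

lemma wp_Seq [simp]:
  "wp D (Seq P R) s Q \<longleftrightarrow> wp D P s (\<lambda>T s'. wp D R s' (\<lambda>U. Q (T + U)))"
  unfolding wp_def by (blast elim: exec_SeqE intro: exec.Seq)

lemma exec_IfLess_iff:
  "exec D (IfLess p q P R) s T s' \<longleftrightarrow>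
    (\<exists>U. T = 1 + U \<and> (if reg s p < reg s q then exec D P s U s' else exec D R s U s'))"
  by (auto elim!: exec_IfE intro: exec.IfTrue[simplified] exec.IfFalse[simplified])

lemma wp_IfLess [simp]:
  "wp D (IfLess p q P R) s Q \<longleftrightarrow>
    (if reg s p < reg s q then wp D P s (\<lambda>T. Q (1 + T)) else wp D R s (\<lambda>T. Q (1 + T)))"
  unfolding wp_def exec_IfLess_iff by auto

text \<open>The invariant is indexed by a counter that rises to \<open>N\<close>. Each round pays
  for the body and one test; the leading 1 is the final failing test.\<close>

lemma wp_WhileLess:
  assumes "I x s" "x \<le> N"
    and test: "\<And>x s. I x s \<Longrightarrow> x \<le> N \<Longrightarrow> reg s p < reg s q \<longleftrightarrow> x < N"
    and body: "\<And>x s. I x s \<Longrightarrow> x < N \<Longrightarrow> wp D P s (\<lambda>T s'. T \<le> B \<and> I (Suc x) s')"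
  shows "wp D (WhileLess p q P) s (\<lambda>T s'. T \<le> 1 + (N - x) * (B + 1) \<and> I N s')"
  using assms(1,2)
proof (induction "N - x" arbitrary: x s)
  case 0
  then have "x = N" by simp
  with 0 test[of x s] have "exec D (WhileLess p q P) s 1 s"
    by (blast intro: exec.WhileFalse)
  with 0 \<open>x = N\<close> show ?case unfolding wp_def by auto
next
  case (Suc m)
  then have "x < N" by simp
  from body[OF Suc.prems(1) this] obtain T s'
    where 1: "exec D P s T s'" "T \<le> B" "I (Suc x) s'"
    unfolding wp_def by blast
  have "m = N - Suc x" "Suc x \<le> N"
    using Suc.hyps(2) by auto
  from Suc.hyps(1)[OF this(1) 1(3) this(2)] obtain U s''
    where 2: "exec D (WhileLess p q P) s' U s''" "U \<le> 1 + m * (B + 1)" "I N s''"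
    unfolding wp_def \<open>m = N - Suc x\<close>[symmetric] by blast
  have "exec D (WhileLess p q P) s (1 + T + U) s''"
    using test[OF Suc.prems] \<open>x < N\<close> 1(1) 2(1) by (blast intro: exec.WhileTrue)
  moreover have "1 + T + U \<le> 1 + (N - x) * (B + 1)"
    using 1(2) 2(2) unfolding Suc.hyps(2)[symmetric] by simp
  ultimately show ?case using 2(3) unfolding wp_def by blast
qed


section \<open>The reduction as a program\<close>

fun seq :: "instr list \<Rightarrow> prog \<Rightarrow> prog"
  where
    "seq [] P = P"
  | "seq (x # xs) P = Seq (Do x) (seq xs P)"

text \<open>
  Registers: 2 is the summand \<open>t\<close>, 3 the output position in the left half of its vector, 4 its kind,
  5 holds \<open>n\<close>, 6 is the loop counter \<open>x\<close>, 10 holds \<open>n + 1\<close>, 11 holds 1 and 12 holds 2. Round \<open>x\<close>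
  writes the entries \<open>x + 1\<close> and \<open>n + x + 1\<close>, whose mirror images are \<open>n - x\<close> and \<open>x + 1\<close>. The query
  relies on registers 5, 10, 11 and 12 being left intact, and finds \<open>t\<close>, \<open>j\<close>, \<open>k\<close> in 2, 3, 4.
\<close>

definition copy_entry :: prog
  where "copy_entry =
    seq [Sub 8 5 6, Add 9 6 11, GetVec 0 2 8, GetVec 1 2 9]
     (Seq (IfLess 4 11 (Do (VZero 1)) (IfLess 4 12 (Do (VZero 0)) Skip))
     (seq [VStore 3 0, Add 7 3 5, VStore 7 1, Add 3 3 11, Add 6 6 11] Skip))"

text \<open>The loop moves register 3 forward by only \<open>n\<close>; the closing
  \<open>Add 3 3 5\<close> skips the right half, filled in the same rounds.\<close>

definition copy_summand :: prog
  where "copy_summand =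
    seq [GetKind 4 2, Store 2 4, Const 6 0]
     (Seq (WhileLess 6 5 copy_entry)
     (seq [Add 3 3 5, Add 2 2 11] Skip))"

definition reduction :: prog
  where "reduction =
    seq [Const 11 1, Const 12 2, Const 2 0, Const 3 0, Add 5 0 2, Add 10 5 11]
     (Seq (WhileLess 2 1 copy_summand)
     (Do (Add 0 5 5)))"

text \<open>The matrix arguments stand for \<open>(j, k)\<close>, \<open>(i, k)\<close> or
  \<open>(i, j)\<close> depending on the kind, so the test for a zero entry must branch on
  it.\<close>

definition matrix_query :: prog
  where "matrix_query =
    Seq (IfLess 5 3 (Do (Sub 8 3 5)) (Do (Sub 8 10 3)))
   (Seq (IfLess 5 4 (Do (Sub 9 4 5)) (Do (Sub 9 10 4)))
   (seq [GetMat 0 2 8 9, GetKind 7 2]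
     (IfLess 7 11 (IfLess 5 3 Skip (Do (VZero 0)))
       (IfLess 7 12 (IfLess 5 3 (Do (VZero 0)) Skip)
         (IfLess 5 3 (Do (VZero 0)) (IfLess 5 4 Skip (Do (VZero 0))))))))"

text \<open>The vectors of the output summands, concatenated with the memory layout of \<^const>\<open>represents\<close>.\<close>

definition vec_layout :: "nat \<Rightarrow> slice list \<Rightarrow> nat \<Rightarrow> real"
  where "vec_layout n D a =
    slice_vec (mirror_slice n (D ! (a div (2 * n)))) (Suc (a mod (2 * n)))"

lemma vec_layout_eq:
  "y < 2 * n \<Longrightarrow> vec_layout n D (t * (2 * n) + y) = slice_vec (mirror_slice n (D ! t)) (Suc y)"
  by (simp add: vec_layout_def)

text \<open>On the left half only a vector indexed by \<open>j\<close> is zeroed; on the right half,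
  only one indexed by \<open>i\<close>.\<close>

lemma vec_layout_left:
  "x < n \<Longrightarrow> vec_layout n D (t * (2 * n) + x) =
    (if slice_kind (D ! t) = 1 then 0 else slice_vec (D ! t) (n - x))"
  by (subst vec_layout_eq) (simp, cases "D ! t", auto simp: mirror_def)

lemma vec_layout_right:
  "x < n \<Longrightarrow> vec_layout n D (t * (2 * n) + x + n) =
    (if slice_kind (D ! t) = 0 then 0 else slice_vec (D ! t) (Suc x))"
  using vec_layout_eq[of "x + n" n D t]
  by (cases "D ! t") (auto simp: mirror_def add.assoc)

section \<open>Loop invariants and step counts\<close>

definition summand_inv :: "slice list \<Rightarrow> nat \<Rightarrow> nat \<Rightarrow> machine \<Rightarrow> bool"
  where "summand_inv D n t s \<longleftrightarrow>
    reg s 1 = length D \<and> reg s 2 = t \<and> reg s 3 = t * (2 * n) \<and> reg s 5 = n \<and>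
    reg s 10 = n + 1 \<and> reg s 11 = 1 \<and> reg s 12 = 2 \<and>
    (\<forall>u<t. mem s u = slice_kind (D ! u)) \<and>
    (\<forall>a<t * (2 * n). vmem s a = vec_layout n D a)"

text \<open>Within a summand two separate stretches grow: one from the start of its block, one from
  the middle. The kind is stored before the loop, hence \<open>u \<le> t\<close>.\<close>

definition entry_inv :: "slice list \<Rightarrow> nat \<Rightarrow> nat \<Rightarrow> nat \<Rightarrow> machine \<Rightarrow> bool"
  where "entry_inv D n t x s \<longleftrightarrow>
    reg s 1 = length D \<and> reg s 2 = t \<and> reg s 3 = t * (2 * n) + x \<and>
    reg s 4 = slice_kind (D ! t) \<and> reg s 5 = n \<and> reg s 6 = x \<and>
    reg s 10 = n + 1 \<and> reg s 11 = 1 \<and> reg s 12 = 2 \<and>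
    (\<forall>u\<le>t. mem s u = slice_kind (D ! u)) \<and>
    (\<forall>a<t * (2 * n) + x. vmem s a = vec_layout n D a) \<and>
    (\<forall>y<x. vmem s (t * (2 * n) + y + n) = vec_layout n D (t * (2 * n) + y + n))"

lemma slice_kind_cases: "slice_kind s = 0 \<or> slice_kind s = 1 \<or> slice_kind s = 2"
  by (cases s) auto

text \<open>Four steps to read, at most three for the kind test and five to write and advance make
  12.\<close>

lemma wp_copy_entry:
  assumes "entry_inv D n t x s" "x < n"
  shows "wp D copy_entry s (\<lambda>T s'. T \<le> 12 \<and> entry_inv D n t (Suc x) s')"
  using assms slice_kind_cases[of "D ! t"] vec_layout_left[OF assms(2), of D t]
    vec_layout_right[OF assms(2), of D t]
  unfolding copy_entry_def
  by (auto simp: entry_inv_def less_Suc_eq)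

lemma wp_copy_summand:
  assumes "summand_inv D n t s"
  shows "wp D copy_summand s (\<lambda>T s'. T \<le> 6 + n * 13 \<and> summand_inv D n (Suc t) s')"
proof -
  have start: "entry_inv D n t 0
      (step D (Const 6 0) (step D (Store 2 4) (step D (GetKind 4 2) s)))"
    using assms by (auto simp: entry_inv_def summand_inv_def)
  have loop: "wp D (WhileLess 6 5 copy_entry) s'
      (\<lambda>T s'. T \<le> 1 + (n - 0) * (12 + 1) \<and> entry_inv D n t n s')"
    if "entry_inv D n t 0 s'" for s'
    using that
  proof (rule wp_WhileLess)
    show "wp D copy_entry s (\<lambda>T s'. T \<le> 12 \<and> entry_inv D n t (Suc x) s')"
      if "entry_inv D n t x s" "x < n" for x s
      using that by (rule wp_copy_entry)
  qed (simp_all add: entry_inv_def)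
  have "summand_inv D n (Suc t) (step D (Add 2 2 11) (step D (Add 3 3 5) s'))"
    if "entry_inv D n t n s'" for s'
  proof -
    \<comment> \<open>After \<open>n\<close> rounds the two stretches meet and fill the block;
      positions from its middle on come from the last clause of \<open>entry_inv\<close>.\<close>
    have "vmem s' a = vec_layout n D a" if "a < Suc t * (2 * n)" for a
    proof (cases "a < t * (2 * n) + n")
      case False
      then have "a = t * (2 * n) + (a - t * (2 * n) - n) + n" "a - t * (2 * n) - n < n"
        using that by auto
      then show ?thesis
        using \<open>entry_inv D n t n s'\<close> unfolding entry_inv_def by metis
    qed (use \<open>entry_inv D n t n s'\<close> in \<open>simp add: entry_inv_def\<close>)
    then show ?thesis
      using that by (auto simp: entry_inv_def summand_inv_def less_Suc_eq_le)
  qed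
  then show ?thesis
    unfolding copy_summand_def
    \<comment> \<open>\<open>step\<close> stays folded so that the state reached matches
      \<open>start\<close>.\<close>
    by (simp del: step.simps) (rule wp_mono[OF loop[OF start]], simp del: step.simps)
qed

lemma wp_reduction:
  "wp D reduction (initial n (length D)) (\<lambda>T s.
    T \<le> 8 + length D * (7 + n * 13) \<and> reg s 0 = 2 * n \<and> summand_inv D n (length D) s)"
proof -
  \<comment> \<open>Register 2 is 0 when \<open>Add 5 0 2\<close> runs, so this instruction copies
    \<open>n\<close>.\<close>
  let ?s = "step D (Add 10 5 11) (step D (Add 5 0 2) (step D (Const 3 0) (step D (Const 2 0)
    (step D (Const 12 2) (step D (Const 11 1) (initial n (length D)))))))"
  have start: "summand_inv D n 0 ?s"
    by (simp add: summand_inv_def initial_def)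
  have loop: "wp D (WhileLess 2 1 copy_summand) ?s
      (\<lambda>T s. T \<le> 1 + (length D - 0) * (6 + n * 13 + 1) \<and> summand_inv D n (length D) s)"
    using start
  proof (rule wp_WhileLess)
    show "wp D copy_summand s (\<lambda>T s'. T \<le> 6 + n * 13 \<and> summand_inv D n (Suc t) s')"
      if "summand_inv D n t s" for t s
      using that by (rule wp_copy_summand)
  qed (simp_all add: summand_inv_def)
  show ?thesis
    unfolding reduction_def
    by (simp del: step.simps One_nat_def) (rule wp_mono[OF loop], auto simp: summand_inv_def)
qed

text \<open>Two steps for each index, two reads and at most five for the zero test make 11, whatever
  \<open>n\<close> and \<open>D\<close> are.\<close>

lemma wp_matrix_query:
  assumes "reg s 5 = n" "reg s 10 = n + 1" "reg s 11 = 1" "reg s 12 = 2"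
    and "reg s 2 = t" "reg s 3 = j" "reg s 4 = k"
  shows "wp D matrix_query s (\<lambda>T s'.
    T \<le> 11 \<and> vreg s' 0 = slice_mat (mirror_slice n (D ! t)) j k)"
  using assms unfolding matrix_query_def
  by (cases "D ! t") (auto simp: mirror_def)

lemma represents_reduction:
  assumes "reg s 0 = 2 * n" "summand_inv D n (length D) s"
  shows "represents D matrix_query 11 s (2 * n) (map (mirror_slice n) D)"
  unfolding represents_def
proof (intro conjI allI impI ballI)
  fix t assume "t < length (map (mirror_slice n) D)"
  then have t: "t < length D" by simp
  show "mem s t = slice_kind (map (mirror_slice n) D ! t)"
    using assms t by (cases "D ! t") (auto simp: summand_inv_def)
  show "vmem s (t * (2 * n) + (i - 1)) = slice_vec (map (mirror_slice n) D ! t) i"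
    if i: "i \<in> {1..2 * n}" for i
  proof -
    have "t * (2 * n) + (i - 1) < Suc t * (2 * n)"
      using i by auto
    also have "\<dots> \<le> length D * (2 * n)"
      using t by (intro mult_right_mono) auto
    finally have "vmem s (t * (2 * n) + (i - 1)) = vec_layout n D (t * (2 * n) + (i - 1))"
      using assms unfolding summand_inv_def by blast
    then show ?thesis
      using i t vec_layout_eq[of "i - 1" n D t] by auto
  qed
  show "\<exists>T s'. exec D matrix_query (s\<lparr>reg := (reg s)(2 := t, 3 := j, 4 := k)\<rparr>) T s' \<and>
      T \<le> 11 \<and> vreg s' 0 = slice_mat (map (mirror_slice n) D ! t) j k" for j k
    using wp_matrix_query[of "s\<lparr>reg := (reg s)(2 := t, 3 := j, 4 := k)\<rparr>" n t j k D] assms t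
    by (simp add: summand_inv_def wp_def)
qed (use assms in \<open>simp_all add: summand_inv_def\<close>)

theorem theorem4p3:
  shows "\<exists>(reduce :: prog) (query :: prog) (c :: nat).
    \<forall>(n :: nat) (d :: nat) (w :: nat \<Rightarrow> nat \<Rightarrow> nat \<Rightarrow> int) (D :: slice list).
      n \<ge> 1 \<longrightarrow> d \<ge> 1 \<longrightarrow> length D = d \<longrightarrow> slice_decomposition n D w \<longrightarrow>
      (\<exists>(T :: nat) (s :: machine) (D' :: slice list) (w' :: nat \<Rightarrow> nat \<Rightarrow> nat \<Rightarrow> int).
        exec D reduce (initial n d) T s \<and> T \<le> c * (n * d) \<and>
        represents D query c s (2 * n) D' \<and> length D' = d \<and>
        slice_decomposition (2 * n) D' w' \<and>
        lws2d_pt (2 * n) (int_weights w') = lws2d n (int_weights w) (int_weights w))"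
proof -
  have "\<exists>T s D' w'. exec D reduction (initial n d) T s \<and> T \<le> 28 * (n * d) \<and>
      represents D matrix_query 28 s (2 * n) D' \<and> length D' = d \<and>
      slice_decomposition (2 * n) D' w' \<and>
      lws2d_pt (2 * n) (int_weights w') = lws2d n (int_weights w) (int_weights w)"
    if "1 \<le> n" "1 \<le> d" and d: "length D = d" and w: "slice_decomposition n D w"
    for n d w and D :: "slice list"
  proof -
    obtain T s where run: "exec D reduction (initial n d) T s" "T \<le> 8 + d * (7 + n * 13)"
      "reg s 0 = 2 * n" "summand_inv D n (length D) s"
      using wp_reduction[of D n] unfolding wp_def d by blast
    \<comment> \<open>These absorb the lower-order terms: \<open>28 = 8 + 7 + 13\<close>.\<close>
    have "1 \<le> n * d" "d \<le> n * d"
      using that(1,2) by (simp_all add: Suc_le_eq)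
    moreover have "d * (7 + n * 13) = 7 * d + 13 * (n * d)"
      by (simp add: algebra_simps)
    ultimately have "T \<le> 28 * (n * d)"
      using run(2) by linarith
    \<comment> \<open>One constant must serve both bounds, so the query bound 11 is relaxed to
      28.\<close>
    moreover have "represents D matrix_query 28 s (2 * n) (map (mirror_slice n) D)"
      using represents_reduction[OF run(3,4)] unfolding represents_def by fastforce
    ultimately show ?thesis
      using run(1) d slice_decomposition_mirror[OF w] lws2d_pt_mirror[OF that(1)]
      by (metis length_map)
  qed
  then show ?thesis by blast
qed

end
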